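(* The only bipartite planar squco graph is $K_1$. That is, if $G$ is a finite simple graph that is bipartite, planar, and satisfies $G^2 \cong \overline{G}$, then $G$ has exactly one vertex.
   Context: All graphs are finite and simple. The square $G^2$ of a graph $G$ has vertex set $V(G)$, and two distinct vertices are adjacent in $G^2$ if and only if their distance in $G$ is at most $2$. A graph $G$ is square-complementary (squco) if $G^2$ is isomorphic to the complement $\overline{G}$ of $G$. $K_1$ denotes the graph with one vertex. *)

theory Defs
  imports
    "HOL-Analysis.Analysis"
    "Graph_Theory.Pair_Digraph"
    "Graph_Theory.Digraph_Isomorphism"
    "Graph_Theory.Shortest_Path"
begin

text \<open>
  A finite simple graph is a \<^locale>\<open>pair_graph\<close>: an edge between \<open>u\<close> and \<open>v\<close> is the pair of
  opposite arcs \<open>(u, v)\<close>, \<open>(v, u)\<close>. That locale also admits the graph without vertices.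
\<close>

text \<open>
  The distance is the minimal number of arcs on a walk; it is \<open>\<infinity>\<close> between different components.
\<close>

definition graph_dist :: "'a pair_pre_digraph \<Rightarrow> 'a \<Rightarrow> 'a \<Rightarrow> ereal" where
  "graph_dist G u v = wf_digraph.\<mu> (with_proj G) (\<lambda>_. 1) u v"

definition graph_square :: "'a pair_pre_digraph \<Rightarrow> 'a pair_pre_digraph" where
  "graph_square G = \<lparr> pverts = pverts G,
     parcs = {(u, v). u \<in> pverts G \<and> v \<in> pverts G \<and> u \<noteq> v \<and> graph_dist G u v \<le> 2} \<rparr>"

definition graph_complement :: "'a pair_pre_digraph \<Rightarrow> 'a pair_pre_digraph" where
  "graph_complement G = \<lparr> pverts = pverts G,
     parcs = {(u, v). u \<in> pverts G \<and> v \<in> pverts G \<and> u \<noteq> v \<and> (u, v) \<notin> parcs G} \<rparr>"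

definition squco :: "'a pair_pre_digraph \<Rightarrow> bool" where
  "squco G \<longleftrightarrow> digraph_iso (with_proj (graph_square G)) (with_proj (graph_complement G))"

definition bipartite :: "'a pair_pre_digraph \<Rightarrow> bool" where
  "bipartite G \<longleftrightarrow> (\<exists>A B. A \<union> B = pverts G \<and> A \<inter> B = {} \<and> parcs G \<subseteq> A \<times> B \<union> B \<times> A)"

text \<open>
  A drawing of \<open>G\<close> without crossings in the plane, taken to be \<^typ>\<open>complex\<close>. Curves are indexed
  by the sets \<open>{u, v}\<close>, so that opposite arcs share one curve, of unspecified direction.
\<close>

definition plane_drawing ::
  "'a pair_pre_digraph \<Rightarrow> ('a \<Rightarrow> complex) \<Rightarrow> ('a set \<Rightarrow> real \<Rightarrow> complex) \<Rightarrow> bool" where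
  "plane_drawing G p \<gamma> \<longleftrightarrow>
     inj_on p (pverts G) \<and>
     (\<forall>(u, v) \<in> parcs G.
        arc (\<gamma> {u, v}) \<and>
        {pathstart (\<gamma> {u, v}), pathfinish (\<gamma> {u, v})} = {p u, p v} \<and>
        path_image (\<gamma> {u, v}) \<inter> p ` pverts G = {p u, p v}) \<and>
     (\<forall>(u, v) \<in> parcs G. \<forall>(x, y) \<in> parcs G. {u, v} \<noteq> {x, y} \<longrightarrow>
        path_image (\<gamma> {u, v}) \<inter> path_image (\<gamma> {x, y}) \<subseteq> p ` pverts G)"

definition planar :: "'a pair_pre_digraph \<Rightarrow> bool" where
  "planar G \<longleftrightarrow> (\<exists>p \<gamma>. plane_drawing G p \<gamma>)"

end

theory Submission
  imports Defs
begin

text \<open>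
  Let \<open>H\<close> be the graph of the pairs at distance at least \<open>3\<close>; a squco graph is isomorphic to its \<open>H\<close>,
  so if \<open>G\<close> is bipartite and planar, then so is \<open>H\<close>. Let \<open>G\<close> have at least two vertices and sides
  \<open>A\<close>, \<open>B\<close>. Since \<open>H\<close> contains no triangle, two vertices of the same side without common neighbour
  have complementary neighbourhoods. If such a pair exists, it fixes the bipartition of \<open>H\<close> well enough
  to show that no such pair exists in \<open>H\<close>, which is absurd. So \<open>H\<close> is the bipartite complement of \<open>G\<close>,
  and in both graphs any two vertices of the same side have a common neighbour.

  Now contract the star of some \<open>x \<in> A\<close>: it is adjacent to all of \<open>A - {x}\<close>, so the graph between
  \<open>A - {x}\<close> and the non-neighbours \<open>W\<close> of \<open>x\<close> contains no theta graph whose three paths meet \<open>A\<close> in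
  their interiors, since this would be a \<open>K\<^sub>3\<^sub>,\<^sub>3\<close> minor of \<open>G\<close>. The neighbourhoods of the members of
  \<open>W\<close> intersect pairwise but have no common point, so three members of a smallest such subfamily
  form a triangle \<open>w\<^sub>1, w\<^sub>2, w\<^sub>3\<close> with corners \<open>y\<^sub>1, y\<^sub>2, y\<^sub>3\<close>. In particular all degrees are at least \<open>3\<close>,
  each \<open>w\<^sub>i\<close> has a private neighbour \<open>z\<^sub>i\<close>, and the same minor argument in \<open>H\<close> yields
  \<open>A = {x, y\<^sub>1, y\<^sub>2, y\<^sub>3, z\<^sub>1, z\<^sub>2, z\<^sub>3}\<close>. Likewise \<open>|B| = 7\<close>. But \<open>G\<close> and \<open>H\<close> have equally many edges,
  and these partition the \<open>49\<close> pairs in \<open>A \<times> B\<close>.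
\<close>

\<comment> \<open>It shadows the topological predicate of the same name.\<close>
hide_const (open) Digraph_Component.connected

subsection \<open>Theta curves\<close>

lemma connected_insert_closure:
  assumes "connected X" "e \<in> closure X"
  shows "connected (insert e X)"
  using assms(1) by (rule connected_intermediate_closure) (use assms(2) closure_subset in auto)

text \<open>
  A component \<open>D\<close> of the complement of \<open>c1 \<union> c2\<close> that avoids \<open>X\<close> also avoids \<open>c3\<close>, as \<open>X\<close> touches
  \<open>c3\<close>. Since \<open>D\<close> has \<open>c1 \<union> c2\<close> as frontier, \<open>X\<close> and \<open>D\<close> are linked through a point of \<open>c1\<close> outside
  \<open>c2 \<union> c3\<close> and through a point of \<open>c2\<close> outside \<open>c1 \<union> c3\<close>, whence, by Janiszewski's theorem, outside
  all three arcs.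
\<close>

lemma no_connected_set_touching_theta:
  fixes c1 c2 c3 :: "real \<Rightarrow> complex"
  assumes c1: "arc c1" "pathstart c1 = a" "pathfinish c1 = b"
    and c2: "arc c2" "pathstart c2 = a" "pathfinish c2 = b"
    and c3: "arc c3" "pathstart c3 = a" "pathfinish c3 = b"
    and c12: "path_image c1 \<inter> path_image c2 = {a, b}"
    and c13: "path_image c1 \<inter> path_image c3 = {a, b}"
    and c23: "path_image c2 \<inter> path_image c3 = {a, b}"
    and X: "connected X" "X \<inter> (path_image c1 \<union> path_image c2 \<union> path_image c3) = {}"
    and e1: "e1 \<in> closure X" "e1 \<in> path_image c1 - {a, b}"
    and e2: "e2 \<in> closure X" "e2 \<in> path_image c2 - {a, b}"
    and e3: "e3 \<in> closure X" "e3 \<in> path_image c3 - {a, b}"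
  shows False
proof -
  define J where "J = path_image c1 \<union> path_image c2"
  define c where "c = c1 +++ reversepath c2"
  have c: "simple_path c" "pathfinish c = pathstart c"
    unfolding c_def using c1 c2 c12
    by (simp_all add: simple_path_join_loop arc_reversepath)
  have Jc: "path_image c = J"
    unfolding c_def J_def using c1 c2 by (simp add: path_image_join)
  define Y where "Y = X \<union> (path_image c3 - {a, b})"
  \<comment> \<open>\<open>e3\<close> is added to \<open>X\<close> only as a common point of the two
    connected sets; it lies in \<open>Y\<close> anyway.\<close>
  have "connected (insert e3 X \<union> (path_image c3 - {a, b}))"
  proof (rule connected_Un)
    show "connected (path_image c3 - {a, b})"
      using connected_simple_path_endless[OF arc_imp_simple_path[OF c3(1)]] c3 by simp
    show "connected (insert e3 X)"
      using X(1) e3(1) by (rule connected_insert_closure)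
  qed (use e3 in blast)
  then have Y: "connected Y"
    using e3 by (simp add: Y_def insert_absorb)
  have YJ: "Y \<inter> J = {}"
    using X c13 c23 by (auto simp: Y_def J_def)
  obtain O1 O2 where O: "connected O1" "connected O2" "O1 \<noteq> {}" "O2 \<noteq> {}"
      "O1 \<inter> O2 = {}" "O1 \<union> O2 = - J" "frontier O1 = J" "frontier O2 = J" "open O1" "open O2"
    using Jordan_inside_outside[OF c] that[of "inside J" "outside J"] unfolding Jc by simp
  have "X \<noteq> {}" using e1 by auto
  then obtain f where f: "f \<in> X" by auto
  obtain D where D: "connected D" "D \<noteq> {}" "frontier D = J" "D \<inter> Y = {}" "D \<inter> J = {}"
  proof -
    have "O1 \<inter> Y = {} \<or> O2 \<inter> Y = {}"
      using connectedD[OF Y O(9,10)] O(5,6) YJ by auto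
    then show ?thesis
      using that[OF O(1,3,7)] that[OF O(2,4,8)] O(6) by auto
  qed
  obtain z where z: "z \<in> D" using D by auto
  have D3: "D \<inter> path_image c3 = {}"
    using D c13 by (auto simp: Y_def J_def)
  have 1: "connected_component (- (path_image c' \<union> path_image c3)) f z"
    if "e \<in> closure X" "e \<in> J" "e \<notin> path_image c' \<union> path_image c3" "path_image c' \<subseteq> J" for e c'
  proof -
    have "e \<in> closure D"
      using D that by (auto simp: frontier_def)
    then have "connected (insert e X \<union> insert e D)"
      using X(1) D(1) that(1) by (intro connected_Un connected_insert_closure) simp_all
    moreover have "insert e X \<union> insert e D \<subseteq> - (path_image c' \<union> path_image c3)"
      using that X D D3 by (auto simp: J_def)
    ultimately show ?thesis
      using f z unfolding connected_component_def by blast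
  qed
  have "connected_component (- ((path_image c2 \<union> path_image c3) \<union> (path_image c1 \<union> path_image c3))) f z"
  proof (rule Janiszewski)
    show "compact (path_image c2 \<union> path_image c3)"
      using c2 c3 by (simp add: arc_imp_path compact_Un compact_path_image)
    show "closed (path_image c1 \<union> path_image c3)"
      using c1 c3 by (simp add: arc_imp_path closed_Un closed_path_image)
    have "(path_image c2 \<union> path_image c3) \<inter> (path_image c1 \<union> path_image c3) = path_image c3"
      using c12 c13 by auto
    then show "connected ((path_image c2 \<union> path_image c3) \<inter> (path_image c1 \<union> path_image c3))"
      using c3 by (simp add: arc_imp_path connected_path_image)
    show "connected_component (- (path_image c2 \<union> path_image c3)) f z"
      using e1 c12 c13 by (intro 1[of e1]) (auto simp: J_def)
    show "connected_component (- (path_image c1 \<union> path_image c3)) f z"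
      using e2 c12 c23 by (intro 1[of e2]) (auto simp: J_def)
  qed
  then obtain T where T: "connected T" "T \<subseteq> - J" "f \<in> T" "z \<in> T"
    unfolding connected_component_def J_def by blast
  have "T \<inter> frontier D \<noteq> {}"
    using T z D f by (intro connected_Int_frontier) (auto simp: Y_def)
  then show False using T D by auto
qed

subsection \<open>Excluded minors of plane graphs\<close>

text \<open>
  The legs of the tripod \<open>x\<close> may share \<open>n1\<close>, \<open>n2\<close>, \<open>n3\<close>, so these configurations have \<open>K\<^sub>3\<^sub>,\<^sub>3\<close> as a minor
  but need not contain a subdivision in which \<open>x\<close> is a branch vertex.
\<close>

definition tripod_on_K23 :: "('a \<Rightarrow> 'a \<Rightarrow> bool) \<Rightarrow> bool" where
  "tripod_on_K23 E \<longleftrightarrow> (\<exists>x n1 n2 n3 s t p q r.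
     distinct [s, t, p, q, r] \<and> {x, n1, n2, n3} \<inter> {s, t, p, q, r} = {} \<and>
     E x n1 \<and> E x n2 \<and> E x n3 \<and> E n1 p \<and> E n2 q \<and> E n3 r \<and>
     E s p \<and> E p t \<and> E s q \<and> E q t \<and> E s r \<and> E r t)"

definition tripod_on_subdivided_K23 :: "('a \<Rightarrow> 'a \<Rightarrow> bool) \<Rightarrow> bool" where
  "tripod_on_subdivided_K23 E \<longleftrightarrow> (\<exists>x n1 n2 n3 s t p q r w r'.
     distinct [s, t, p, q, r, w, r'] \<and> {x, n1, n2, n3} \<inter> {s, t, p, q, r, w, r'} = {} \<and>
     E x n1 \<and> E x n2 \<and> E x n3 \<and> E n1 p \<and> E n2 q \<and> E n3 r \<and>
     E s p \<and> E p t \<and> E s q \<and> E q t \<and> E s r \<and> E r w \<and> E w r' \<and> E r' t)"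

lemma tripod_on_K23I:
  assumes "distinct [s, t, p, q, r]" "{x, n1, n2, n3} \<inter> {s, t, p, q, r} = {}"
    and "E x n1" "E x n2" "E x n3" "E n1 p" "E n2 q" "E n3 r"
    and "E s p" "E p t" "E s q" "E q t" "E s r" "E r t"
  shows "tripod_on_K23 E"
  unfolding tripod_on_K23_def by (intro exI conjI) (fact assms)+

lemma tripod_on_subdivided_K23I:
  assumes "distinct [s, t, p, q, r, w, r']" "{x, n1, n2, n3} \<inter> {s, t, p, q, r, w, r'} = {}"
    and "E x n1" "E x n2" "E x n3" "E n1 p" "E n2 q" "E n3 r"
    and "E s p" "E p t" "E s q" "E q t" "E s r" "E r w" "E w r'" "E r' t"
  shows "tripod_on_subdivided_K23 E"
  unfolding tripod_on_subdivided_K23_def by (intro exI conjI) (fact assms)+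

section \<open>Paths as edge sets in a plane drawing\<close>

locale plane_graph =
  fixes G :: "'a pair_pre_digraph" and p :: "'a \<Rightarrow> complex" and \<gamma> :: "'a set \<Rightarrow> real \<Rightarrow> complex"
  assumes graph: "pair_graph G"
    and drawing: "plane_drawing G p \<gamma>"
begin

definition edges :: "'a set set" where
  "edges = {{u, v} | u v. (u, v) \<in> parcs G}"

definition drawn :: "'a set set \<Rightarrow> complex set" where
  "drawn F = (\<Union>e\<in>F. path_image (\<gamma> e))"

text \<open>A path is represented by its edge set, not by a vertex sequence: concatenation is then a
  union, and \<open>drawn_Int\<close> reads intersections of curves off the edge sets.\<close>

definition arc_drawn :: "'a \<Rightarrow> 'a \<Rightarrow> 'a set set \<Rightarrow> bool" where
  "arc_drawn u v F \<longleftrightarrow> F \<subseteq> edges \<and>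
     (\<exists>g. arc g \<and> pathstart g = p u \<and> pathfinish g = p v \<and> path_image g = drawn F)"

lemma inj_p: "inj_on p (pverts G)"
  and edge_arc: "(u, v) \<in> parcs G \<Longrightarrow> arc (\<gamma> {u, v})"
  and edge_ends: "(u, v) \<in> parcs G \<Longrightarrow>
    {pathstart (\<gamma> {u, v}), pathfinish (\<gamma> {u, v})} = {p u, p v}"
  and edge_vertices: "(u, v) \<in> parcs G \<Longrightarrow> path_image (\<gamma> {u, v}) \<inter> p ` pverts G = {p u, p v}"
  and edges_cross: "(u, v) \<in> parcs G \<Longrightarrow> (x, y) \<in> parcs G \<Longrightarrow> {u, v} \<noteq> {x, y} \<Longrightarrow>
    path_image (\<gamma> {u, v}) \<inter> path_image (\<gamma> {x, y}) \<subseteq> p ` pverts G"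
proof -
  note d = drawing[unfolded plane_drawing_def]
  show "inj_on p (pverts G)" using d by (rule conjunct1)
  note edge = d[THEN conjunct2, THEN conjunct1, THEN bspec, of "(u, v)" for u v, simplified]
  show "(u, v) \<in> parcs G \<Longrightarrow> arc (\<gamma> {u, v})"
    "(u, v) \<in> parcs G \<Longrightarrow> {pathstart (\<gamma> {u, v}), pathfinish (\<gamma> {u, v})} = {p u, p v}"
    "(u, v) \<in> parcs G \<Longrightarrow> path_image (\<gamma> {u, v}) \<inter> p ` pverts G = {p u, p v}"
    using edge[of u v] by (blast+)
  show "(u, v) \<in> parcs G \<Longrightarrow> (x, y) \<in> parcs G \<Longrightarrow> {u, v} \<noteq> {x, y} \<Longrightarrow>
      path_image (\<gamma> {u, v}) \<inter> path_image (\<gamma> {x, y}) \<subseteq> p ` pverts G"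
    using bspec[OF bspec[OF d[THEN conjunct2, THEN conjunct2], of "(u, v)", simplified], of "(x, y)"]
    by simp
qed

lemma parcs_verts: "(u, v) \<in> parcs G \<Longrightarrow> u \<in> pverts G \<and> v \<in> pverts G"
  and parcs_sym: "(u, v) \<in> parcs G \<Longrightarrow> (v, u) \<in> parcs G"
proof -
  interpret pair_graph G by (rule graph)
  show "(u, v) \<in> parcs G \<Longrightarrow> u \<in> pverts G \<and> v \<in> pverts G"
    using in_arcsD1 in_arcsD2 by blast
  show "(u, v) \<in> parcs G \<Longrightarrow> (v, u) \<in> parcs G"
    using pair_sym_arcs by (auto simp: symmetric_def dest: symD)
qed

lemma edgesE:
  assumes "F \<subseteq> edges" "e \<in> F"
  obtains u v where "e = {u, v}" "(u, v) \<in> parcs G"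
  using assms unfolding edges_def by blast

lemma Union_edges: "F \<subseteq> edges \<Longrightarrow> \<Union>F \<subseteq> pverts G"
  unfolding edges_def using parcs_verts by fastforce

lemma drawn_vertices:
  assumes "F \<subseteq> edges"
  shows "drawn F \<inter> p ` pverts G = p ` \<Union>F"
proof -
  have "path_image (\<gamma> e) \<inter> p ` pverts G = p ` e" if e: "e \<in> F" for e
  proof -
    obtain u v where "e = {u, v}" "(u, v) \<in> parcs G"
      using edgesE[OF assms e] .
    then show ?thesis using edge_vertices[of u v] by simp
  qed
  then have "(\<Union>e\<in>F. p ` pverts G \<inter> path_image (\<gamma> e)) = (\<Union>e\<in>F. p ` e)"
    by (intro SUP_cong[OF refl]) (simp only: Int_commute)
  then have "p ` pverts G \<inter> drawn F = p ` \<Union>F"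
    by (simp only: drawn_def Int_UN_distrib image_Union)
  then show ?thesis by (simp only: Int_commute)
qed

text \<open>Curves of distinct edges meet only in vertices, and a curve passes through no vertices
  but its ends. Injectivity of \<open>p\<close> then moves the intersection under the image.\<close>

lemma drawn_Int:
  assumes "F \<subseteq> edges" "F' \<subseteq> edges" "F \<inter> F' = {}"
  shows "drawn F \<inter> drawn F' = p ` (\<Union>F \<inter> \<Union>F')"
proof -
  have "path_image (\<gamma> e) \<inter> path_image (\<gamma> e') \<subseteq> p ` pverts G" if e: "e \<in> F" "e' \<in> F'" for e e'
  proof -
    obtain u v where "e = {u, v}" "(u, v) \<in> parcs G"
      using edgesE[OF assms(1) e(1)] .
    moreover obtain x y where "e' = {x, y}" "(x, y) \<in> parcs G"
      using edgesE[OF assms(2) e(2)] .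
    moreover have "e \<noteq> e'" using e assms(3) by auto
    ultimately show ?thesis using edges_cross by auto
  qed
  then have "drawn F \<inter> drawn F' \<subseteq> p ` pverts G"
    unfolding drawn_def by blast
  then have "drawn F \<inter> drawn F' = (drawn F \<inter> p ` pverts G) \<inter> (drawn F' \<inter> p ` pverts G)"
    by auto
  also have "\<dots> = p ` (\<Union>F \<inter> \<Union>F')"
    using assms inj_on_image_Int[OF inj_p Union_edges Union_edges]
    by (simp add: drawn_vertices)
  finally show ?thesis .
qed

lemma drawn_disjoint:
  assumes "F \<subseteq> edges" "F' \<subseteq> edges" "\<Union>F \<inter> \<Union>F' = {}"
  shows "drawn F \<inter> drawn F' = {}"
proof -
  have "F \<inter> F' = {}"
    using assms unfolding edges_def by blast
  then show ?thesis using drawn_Int assms by simp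
qed

text \<open>The drawing leaves the direction of \<open>\<gamma> {u, v}\<close> open, so the curve
  may have to be reversed.\<close>

lemma arc_drawn_edge:
  assumes "(u, v) \<in> parcs G"
  shows "arc_drawn u v {{u, v}}"
proof -
  have "{u, v} \<in> edges" using assms by (auto simp: edges_def)
  moreover consider
      "pathstart (\<gamma> {u, v}) = p u" "pathfinish (\<gamma> {u, v}) = p v"
    | "pathstart (\<gamma> {u, v}) = p v" "pathfinish (\<gamma> {u, v}) = p u"
    using edge_ends[OF assms] by (auto simp: doubleton_eq_iff)
  then have "\<exists>g. arc g \<and> pathstart g = p u \<and> pathfinish g = p v \<and> path_image g = drawn {{u, v}}"
  proof cases
    case 1
    then show ?thesis using edge_arc[OF assms] by (auto simp: drawn_def)
  next
    case 2
    then show ?thesis using edge_arc[OF assms]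
      by (intro exI[of _ "reversepath (\<gamma> {u, v})"]) (auto simp: drawn_def arc_reversepath)
  qed
  ultimately show ?thesis by (simp add: arc_drawn_def)
qed

lemma arc_drawn_join:
  assumes "arc_drawn u v F" "arc_drawn v w F'" "F \<inter> F' = {}" "\<Union>F \<inter> \<Union>F' = {v}"
  shows "arc_drawn u w (F \<union> F')"
proof -
  obtain g g' where g: "arc g" "pathstart g = p u" "pathfinish g = p v" "path_image g = drawn F"
    and g': "arc g'" "pathstart g' = p v" "pathfinish g' = p w" "path_image g' = drawn F'"
    using assms unfolding arc_drawn_def by blast
  have F: "F \<subseteq> edges" "F' \<subseteq> edges" using assms by (auto simp: arc_drawn_def)
  have "arc (g +++ g')"
    using g g' drawn_Int[OF F assms(3)] assms(4) by (intro arc_join) auto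
  moreover have "path_image (g +++ g') = drawn (F \<union> F')"
    using g g' by (simp add: path_image_join drawn_def)
  ultimately show ?thesis
    using F g g' unfolding arc_drawn_def by (metis Un_least pathstart_join pathfinish_join)
qed

text \<open>Serves for the last edge of a tripod's leg: without its end on the theta graph it is
  still connected and has that end in its closure.\<close>

lemma half_edge:
  assumes "(u, v) \<in> parcs G"
  shows "connected (drawn {{u, v}} - {p v})"
    and "p u \<in> drawn {{u, v}} - {p v}"
    and "p v \<in> closure (drawn {{u, v}} - {p v})"
proof -
  obtain g where g: "arc g" "pathstart g = p u" "pathfinish g = p v" "path_image g = drawn {{u, v}}"
    using arc_drawn_edge[OF assms] unfolding arc_drawn_def by blast
  have inj: "inj_on g {0..1}" and cont: "continuous_on {0..1} g"
    using g by (auto simp: arc_def path_def)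
  have "drawn {{u, v}} - {p v} = g ` {0..1} - g ` {1}"
    using g by (auto simp: path_image_def pathfinish_def)
  also have "\<dots> = g ` ({0..1} - {1})"
    by (rule inj_on_image_set_diff[OF inj, symmetric]) auto
  also have "{0..1} - {1} = {0..<1::real}" by auto
  finally have eq: "drawn {{u, v}} - {p v} = g ` {0..<1}" .
  show "connected (drawn {{u, v}} - {p v})"
    unfolding eq using cont by (intro connected_continuous_image continuous_on_subset[OF cont]) auto
  show "p u \<in> drawn {{u, v}} - {p v}"
  proof -
    have "g 0 \<in> g ` {0..<1}" by (rule imageI) simp
    then show ?thesis unfolding eq using g(2) by (metis pathstart_def)
  qed
  have "g ` closure {0..<1} \<subseteq> closure (g ` {0..<1})"
    using cont closure_subset[of "g ` {0..<1}"] by (intro image_closure_subset) auto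
  moreover have "g 1 \<in> g ` closure {0..<1}" by (rule imageI) simp
  ultimately show "p v \<in> closure (drawn {{u, v}} - {p v})"
    unfolding eq using g(3) by (metis pathfinish_def subsetD)
qed

text \<open>The legs without their feet \<open>q i\<close> form a connected set off the theta graph
  whose closure reaches the interiors of all three paths, contrary to
  \<open>no_connected_set_touching_theta\<close>.\<close>

lemma no_tripod_on_theta:
  assumes F: "\<And>i. i \<in> I \<Longrightarrow> arc_drawn s t (F i)"
    and disj: "\<And>i j. i \<in> I \<Longrightarrow> j \<in> I \<Longrightarrow> i \<noteq> j \<Longrightarrow> F i \<inter> F j = {} \<and> \<Union>(F i) \<inter> \<Union>(F j) = {s, t}"
    and x: "\<And>i. i \<in> I \<Longrightarrow> (x, n i) \<in> parcs G" "\<And>i. i \<in> I \<Longrightarrow> (n i, q i) \<in> parcs G"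
    and q: "\<And>i. i \<in> I \<Longrightarrow> q i \<in> \<Union>(F i) - {s, t}"
    and off: "\<And>i j. i \<in> I \<Longrightarrow> j \<in> I \<Longrightarrow> {x, n j} \<inter> \<Union>(F i) = {}"
    and I: "I = {0, 1, 2::nat}"
  shows False
proof -
  define leg where "leg i = drawn {{x, n i}} \<union> (drawn {{n i, q i}} - {p (q i)})" for i
  define X where "X = \<Union>(leg ` I)"
  have nq: "q i \<in> pverts G" "p (n i) \<noteq> p (q i)" if "i \<in> I" for i
    using half_edge(2)[OF x(2)[OF that]] parcs_verts[OF x(2)[OF that]] by auto
  have E: "{{x, n i}} \<subseteq> edges" "{{n i, q i}} \<subseteq> edges" if "i \<in> I" for i
    using x that by (auto simp: edges_def)
  have px: "p x \<in> drawn {{x, n i}}" "p (n i) \<in> drawn {{x, n i}}" "connected (drawn {{x, n i}})"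
    if "i \<in> I" for i
    using arc_drawn_edge[OF x(1)[OF that]] unfolding arc_drawn_def
    by (metis pathstart_in_path_image pathfinish_in_path_image connected_arc_image)+
  have "connected (leg i)" if "i \<in> I" for i
    unfolding leg_def using px[OF that] half_edge[OF x(2)[OF that]]
    by (intro connected_Un) auto
  moreover have "p x \<in> \<Inter>(leg ` I)"
    using px(1) by (auto simp: leg_def)
  ultimately have "connected X"
    unfolding X_def by (intro connected_Union) auto
  have leg_off: "leg j \<inter> drawn (F i) = {}" if "i \<in> I" "j \<in> I" for i j
  proof -
    have Fi: "F i \<subseteq> edges" using F[OF that(1)] by (simp add: arc_drawn_def)
    have "drawn {{x, n j}} \<inter> drawn (F i) = {}"
      using drawn_disjoint[OF E(1)[OF that(2)] Fi] off[OF that] by auto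
    moreover have "drawn {{n j, q j}} \<inter> drawn (F i) \<subseteq> {p (q j)}"
    proof -
      \<comment> \<open>\<open>n j\<close> lies on none of the paths, so this edge can meet
        \<open>drawn (F i)\<close> only in its foot, which the leg omits.\<close>
      have "{n j, q j} \<notin> F i" using off[OF that] by blast
      then have "drawn {{n j, q j}} \<inter> drawn (F i) = p ` ({n j, q j} \<inter> \<Union>(F i))"
        using drawn_Int[OF E(2)[OF that(2)] Fi] by simp
      then show ?thesis using off[OF that] by auto
    qed
    ultimately show ?thesis unfolding leg_def by blast
  qed
  have touch: "p (q i) \<in> closure X" if "i \<in> I" for i
    using half_edge(3)[OF x(2)[OF that]] closure_mono[of "drawn {{n i, q i}} - {p (q i)}" X] that
    by (auto simp: X_def leg_def)
  have st: "s \<in> pverts G" "t \<in> pverts G"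
  proof -
    have "{s, t} = \<Union>(F 0) \<inter> \<Union>(F 1)" using disj[of 0 1] I by simp
    moreover have "\<Union>(F 0) \<subseteq> pverts G"
      using F[of 0] I by (intro Union_edges) (simp add: arc_drawn_def)
    ultimately show "s \<in> pverts G" "t \<in> pverts G" by blast+
  qed
  have q_on: "p (q i) \<in> drawn (F i) - {p s, p t}" if "i \<in> I" for i
  proof -
    have "p (q i) \<in> drawn (F i)"
      using drawn_vertices[of "F i"] F[OF that] q[OF that] by (auto simp: arc_drawn_def)
    moreover have "p (q i) \<noteq> p s" "p (q i) \<noteq> p t"
      using q[OF that] inj_on_eq_iff[OF inj_p nq(1)[OF that]] st by auto
    ultimately show ?thesis by simp
  qed
  have "\<forall>i\<in>I. \<exists>g. arc g \<and> pathstart g = p s \<and> pathfinish g = p t \<and> path_image g = drawn (F i)"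
    using F unfolding arc_drawn_def by blast
  then obtain c where c: "\<And>i. i \<in> I \<Longrightarrow> arc (c i)" "\<And>i. i \<in> I \<Longrightarrow> pathstart (c i) = p s"
      "\<And>i. i \<in> I \<Longrightarrow> pathfinish (c i) = p t" "\<And>i. i \<in> I \<Longrightarrow> path_image (c i) = drawn (F i)"
    by metis
  have Int: "path_image (c i) \<inter> path_image (c j) = {p s, p t}" if "i \<in> I" "j \<in> I" "i \<noteq> j" for i j
    using drawn_Int[of "F i" "F j"] F[OF that(1)] F[OF that(2)] disj[OF that] c(4) that
    by (simp add: arc_drawn_def)
  have i: "0 \<in> I" "1 \<in> I" "2 \<in> I" using I by auto
  show False
  proof (rule no_connected_set_touching_theta[of "c 0" "p s" "p t" "c 1" "c 2" X
        "p (q 0)" "p (q 1)" "p (q 2)"])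
    have "X \<inter> path_image (c i) = {}" if "i \<in> I" for i
      using leg_off[OF that] c(4)[OF that] by (auto simp: X_def)
    then show "X \<inter> (path_image (c 0) \<union> path_image (c 1) \<union> path_image (c 2)) = {}"
      using i by (simp add: Int_Un_distrib)
    show "p (q 0) \<in> path_image (c 0) - {p s, p t}" "p (q 1) \<in> path_image (c 1) - {p s, p t}"
      "p (q 2) \<in> path_image (c 2) - {p s, p t}"
      using q_on i c(4) by simp_all
    show "path_image (c 0) \<inter> path_image (c 1) = {p s, p t}"
      "path_image (c 0) \<inter> path_image (c 2) = {p s, p t}"
      "path_image (c 1) \<inter> path_image (c 2) = {p s, p t}"
      by (rule Int; use i in simp)+
  qed (fact c(1-3)[OF i(1)] c(1-3)[OF i(2)] c(1-3)[OF i(3)] touch[OF i(1)] touch[OF i(2)]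
      touch[OF i(3)] \<open>connected X\<close>)+
qed

lemma arc_drawn_path3:
  assumes "(s, q) \<in> parcs G" "(q, t) \<in> parcs G" "distinct [s, q, t]"
  shows "arc_drawn s t {{s, q}, {q, t}}"
proof -
  have "arc_drawn s t ({{s, q}} \<union> {{q, t}})"
    using assms(3)
    by (intro arc_drawn_join[OF arc_drawn_edge[OF assms(1)] arc_drawn_edge[OF assms(2)]])
      (auto simp: doubleton_eq_iff)
  then show ?thesis by (simp add: insert_commute)
qed

lemma path3_meet:
  assumes "q \<notin> \<Union>F" "s \<in> \<Union>F" "t \<in> \<Union>F"
  shows "{{s, q}, {q, t}} \<inter> F = {}" "\<Union>{{s, q}, {q, t}} \<inter> \<Union>F = {s, t}"
  using assms by auto

text \<open>Common form of the two excluded configurations: the paths through \<open>a\<close> and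
  \<open>b\<close> have length two, while \<open>P\<close> is left open and only has
  \<open>c\<close> as an inner vertex.\<close>

lemma no_tripod_on_paths:
  assumes P: "arc_drawn s t P" "s \<in> \<Union>P" "t \<in> \<Union>P" "c \<in> \<Union>P" "c \<noteq> s" "c \<noteq> t"
    and ab: "a \<notin> \<Union>P" "b \<notin> \<Union>P" "a \<noteq> b" "s \<noteq> t"
    and e: "(s, a) \<in> parcs G" "(a, t) \<in> parcs G" "(s, b) \<in> parcs G" "(b, t) \<in> parcs G"
    and x: "(x, n1) \<in> parcs G" "(x, n2) \<in> parcs G" "(x, n3) \<in> parcs G"
      "(n1, a) \<in> parcs G" "(n2, b) \<in> parcs G" "(n3, c) \<in> parcs G"
    and off: "{x, n1, n2, n3} \<inter> \<Union>P = {}" "{x, n1, n2, n3} \<inter> {a, b} = {}"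
  shows False
proof -
  have ne: "a \<noteq> s" "a \<noteq> t" "b \<noteq> s" "b \<noteq> t" using ab P by auto
  define P1 where "P1 = {{s, a}, {a, t}}"
  define P2 where "P2 = {{s, b}, {b, t}}"
  have U: "\<Union>P1 = {s, a, t}" "\<Union>P2 = {s, b, t}" unfolding P1_def P2_def by auto
  have arcs: "arc_drawn s t P1" "arc_drawn s t P2"
    unfolding P1_def P2_def using e ne ab by (intro arc_drawn_path3; simp)+
  have "a \<notin> \<Union>P2" "s \<in> \<Union>P2" "t \<in> \<Union>P2"
    using U ne ab by simp_all
  then have meet12: "P1 \<inter> P2 = {} \<and> \<Union>P1 \<inter> \<Union>P2 = {s, t}"
    unfolding P1_def by (intro conjI path3_meet)
  have meet13: "P1 \<inter> P = {} \<and> \<Union>P1 \<inter> \<Union>P = {s, t}"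
    unfolding P1_def using ab P by (intro conjI path3_meet)
  have meet23: "P2 \<inter> P = {} \<and> \<Union>P2 \<inter> \<Union>P = {s, t}"
    unfolding P2_def using ab P by (intro conjI path3_meet)
  have offP: "{x, n1, n2, n3} \<inter> \<Union>P1 = {}" "{x, n1, n2, n3} \<inter> \<Union>P2 = {}"
    unfolding U using off P(2,3) by auto
  show False
  proof (rule no_tripod_on_theta[of "{0, 1, 2}" s t "nth [P1, P2, P]" x "nth [n1, n2, n3]"
        "nth [a, b, c]"])
    show "{x, [n1, n2, n3] ! j} \<inter> \<Union>([P1, P2, P] ! i) = {}"
      if "i \<in> {0, 1, 2}" "j \<in> {0, 1, 2}" for i j
    proof -
      have "{x, [n1, n2, n3] ! j} \<subseteq> {x, n1, n2, n3}" using that(2) by auto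
      moreover have "{x, n1, n2, n3} \<inter> \<Union>([P1, P2, P] ! i) = {}"
        using that(1) off(1) offP by (elim insertE emptyE) simp_all
      ultimately show ?thesis by blast
    qed
    show "[P1, P2, P] ! i \<inter> [P1, P2, P] ! j = {} \<and>
        \<Union>([P1, P2, P] ! i) \<inter> \<Union>([P1, P2, P] ! j) = {s, t}"
      if "i \<in> {0, 1, 2}" "j \<in> {0, 1, 2}" "i \<noteq> j" for i j
      using that(1)
    proof (elim insertE emptyE)
      assume "i = 0"
      then show ?thesis using that(2,3) meet12 meet13
        by (elim insertE emptyE) (simp_all add: Int_commute)
    next
      assume "i = 1"
      then show ?thesis using that(2,3) meet12 meet23
        by (elim insertE emptyE) (simp_all add: Int_commute)
    next
      assume "i = 2"
      then show ?thesis using that(2,3) meet13 meet23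
        by (elim insertE emptyE) (simp_all add: Int_commute)
    qed
    show "[a, b, c] ! i \<in> \<Union>([P1, P2, P] ! i) - {s, t}" if "i \<in> {0, 1, 2}" for i
      using that U ne P by (elim insertE emptyE) simp_all
  qed (use arcs P x in \<open>auto simp del: Union_iff\<close>)
qed

lemma no_tripod_on_K23: "\<not> tripod_on_K23 (\<lambda>u v. (u, v) \<in> parcs G)"
proof
  assume "tripod_on_K23 (\<lambda>u v. (u, v) \<in> parcs G)"
  then obtain x n1 n2 n3 s t a b c where d: "distinct [s, t, a, b, c]"
    and off: "{x, n1, n2, n3} \<inter> {s, t, a, b, c} = {}"
    and x: "(x, n1) \<in> parcs G" "(x, n2) \<in> parcs G" "(x, n3) \<in> parcs G"
      "(n1, a) \<in> parcs G" "(n2, b) \<in> parcs G" "(n3, c) \<in> parcs G"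
    and e: "(s, a) \<in> parcs G" "(a, t) \<in> parcs G" "(s, b) \<in> parcs G" "(b, t) \<in> parcs G"
    and P: "(s, c) \<in> parcs G" "(c, t) \<in> parcs G"
    unfolding tripod_on_K23_def by (elim exE conjE)
  show False
  proof (rule no_tripod_on_paths[OF _ _ _ _ _ _ _ _ _ _ e x])
    show "arc_drawn s t {{s, c}, {c, t}}"
      using P d by (intro arc_drawn_path3) auto
    show "{x, n1, n2, n3} \<inter> \<Union>{{s, c}, {c, t}} = {}" "{x, n1, n2, n3} \<inter> {a, b} = {}"
      using off by simp_all
  qed (use d in auto)
qed

lemma no_tripod_on_subdivided_K23: "\<not> tripod_on_subdivided_K23 (\<lambda>u v. (u, v) \<in> parcs G)"
proof
  assume "tripod_on_subdivided_K23 (\<lambda>u v. (u, v) \<in> parcs G)"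
  then obtain x n1 n2 n3 s t a b c w c' where d: "distinct [s, t, a, b, c, w, c']"
    and off: "{x, n1, n2, n3} \<inter> {s, t, a, b, c, w, c'} = {}"
    and x: "(x, n1) \<in> parcs G" "(x, n2) \<in> parcs G" "(x, n3) \<in> parcs G"
      "(n1, a) \<in> parcs G" "(n2, b) \<in> parcs G" "(n3, c) \<in> parcs G"
    and e: "(s, a) \<in> parcs G" "(a, t) \<in> parcs G" "(s, b) \<in> parcs G" "(b, t) \<in> parcs G"
    and P: "(s, c) \<in> parcs G" "(c, w) \<in> parcs G" "(w, c') \<in> parcs G" "(c', t) \<in> parcs G"
    unfolding tripod_on_subdivided_K23_def by (elim exE conjE)
  show False
  proof (rule no_tripod_on_paths[OF _ _ _ _ _ _ _ _ _ _ e x])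
    \<comment> \<open>The third path is joined from \<open>s c w\<close> and \<open>w c' t\<close>,
      whose only common vertex has to be \<open>w\<close>.\<close>
    have "c \<notin> \<Union>{{w, c'}, {c', t}}" using d by auto
    moreover have "s \<notin> \<Union>{{w, c'}, {c', t}}" using d by auto
    ultimately show "arc_drawn s t ({{s, c}, {c, w}} \<union> {{w, c'}, {c', t}})"
      using d by (intro arc_drawn_join[where v = w] arc_drawn_path3 P) auto
    show "{x, n1, n2, n3} \<inter> \<Union>({{s, c}, {c, w}} \<union> {{w, c'}, {c', t}}) = {}"
      "{x, n1, n2, n3} \<inter> {a, b} = {}"
      using off by simp_all
  qed (use d in auto)
qed

end

subsection \<open>Bipartite graphs with planar bipartite complement\<close>

text \<open>Exchanging \<open>E\<close> with \<open>F\<close> or \<open>A\<close> with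
  \<open>B\<close> preserves the assumptions, so each result comes in four versions.\<close>

locale co_planar_bipartite =
  fixes A B :: "'a set" and E F :: "'a \<Rightarrow> 'a \<Rightarrow> bool"
  assumes finite_A: "finite A" and finite_B: "finite B" and disjoint: "A \<inter> B = {}"
    and symE: "E u v \<Longrightarrow> E v u" and symF: "F u v \<Longrightarrow> F v u"
    and compl: "a \<in> A \<Longrightarrow> b \<in> B \<Longrightarrow> F a b \<longleftrightarrow> \<not> E a b"
    and nonempty: "A \<noteq> {}"
    and nbrE_A: "a \<in> A \<Longrightarrow> \<exists>b\<in>B. E a b" and nbrE_B: "b \<in> B \<Longrightarrow> \<exists>a\<in>A. E a b"
    and nbrF_A: "a \<in> A \<Longrightarrow> \<exists>b\<in>B. F a b" and nbrF_B: "b \<in> B \<Longrightarrow> \<exists>a\<in>A. F a b"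
    and comE_A: "x \<in> A \<Longrightarrow> y \<in> A \<Longrightarrow> x \<noteq> y \<Longrightarrow> \<exists>b\<in>B. E x b \<and> E y b"
    and comE_B: "x \<in> B \<Longrightarrow> y \<in> B \<Longrightarrow> x \<noteq> y \<Longrightarrow> \<exists>a\<in>A. E a x \<and> E a y"
    and comF_A: "x \<in> A \<Longrightarrow> y \<in> A \<Longrightarrow> x \<noteq> y \<Longrightarrow> \<exists>b\<in>B. F x b \<and> F y b"
    and comF_B: "x \<in> B \<Longrightarrow> y \<in> B \<Longrightarrow> x \<noteq> y \<Longrightarrow> \<exists>a\<in>A. F a x \<and> F a y"
    and no_K23: "\<not> tripod_on_K23 E" "\<not> tripod_on_K23 F"
    and no_subdivided_K23: "\<not> tripod_on_subdivided_K23 E" "\<not> tripod_on_subdivided_K23 F"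
begin

lemma swap_relations: "co_planar_bipartite A B F E"
proof
  show "E a b \<longleftrightarrow> \<not> F a b" if "a \<in> A" "b \<in> B" for a b
    using compl that by blast
qed (fact finite_A finite_B disjoint symE symF nonempty nbrE_A nbrE_B nbrF_A nbrF_B
      comE_A comE_B comF_A comF_B no_K23 no_subdivided_K23)+

lemma swap_sides: "co_planar_bipartite B A E F"
proof
  show "B \<inter> A = {}" using disjoint by blast
  show "B \<noteq> {}" using nonempty nbrE_A by blast
  show "F b a \<longleftrightarrow> \<not> E b a" if "b \<in> B" "a \<in> A" for a b
    using compl that symE symF by blast
  show "\<exists>a\<in>A. E b a" if "b \<in> B" for b using nbrE_B[OF that] symE by blast
  show "\<exists>b\<in>B. E b a" if "a \<in> A" for a using nbrE_A[OF that] symE by blast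
  show "\<exists>a\<in>A. F b a" if "b \<in> B" for b using nbrF_B[OF that] symF by blast
  show "\<exists>b\<in>B. F b a" if "a \<in> A" for a using nbrF_A[OF that] symF by blast
  show "\<exists>a\<in>A. E x a \<and> E y a" if "x \<in> B" "y \<in> B" "x \<noteq> y" for x y
    using comE_B[OF that] symE by blast
  show "\<exists>b\<in>B. E b x \<and> E b y" if "x \<in> A" "y \<in> A" "x \<noteq> y" for x y
    using comE_A[OF that] symE by blast
  show "\<exists>a\<in>A. F x a \<and> F y a" if "x \<in> B" "y \<in> B" "x \<noteq> y" for x y
    using comF_B[OF that] symF by blast
  show "\<exists>b\<in>B. F b x \<and> F b y" if "x \<in> A" "y \<in> A" "x \<noteq> y" for x y
    using comF_A[OF that] symF by blast
qed (fact finite_A finite_B symE symF no_K23 no_subdivided_K23)+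

text \<open>In \<open>E\<close> this is a hexagon \<open>w1 y2 w3 y1 w2 y3\<close>, in which each
  \<open>yi\<close> is opposite to \<open>wi\<close>, with \<open>x\<close> adjacent to none of the
  \<open>wi\<close>.\<close>

definition triangle :: "'a \<Rightarrow> 'a \<Rightarrow> 'a \<Rightarrow> 'a \<Rightarrow> 'a \<Rightarrow> 'a \<Rightarrow> 'a \<Rightarrow> bool" where
  "triangle x w1 w2 w3 y1 y2 y3 \<longleftrightarrow>
     {w1, w2, w3} \<subseteq> B \<and> {y1, y2, y3} \<subseteq> A \<and> F x w1 \<and> F x w2 \<and> F x w3 \<and>
     F y1 w1 \<and> E y2 w1 \<and> E y3 w1 \<and> E y1 w2 \<and> F y2 w2 \<and> E y3 w2 \<and> E y1 w3 \<and> E y2 w3 \<and> F y3 w3"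

text \<open>Three paths lead from \<open>w1\<close> to \<open>w2\<close>: through \<open>y3\<close>,
  through \<open>a\<close>, and along \<open>y2 w3 y1\<close>. As \<open>x\<close> is adjacent to no
  \<open>wi\<close>, its common neighbours with \<open>y3\<close>, \<open>a\<close> and
  \<open>y2\<close> avoid these paths and give a tripod.\<close>

lemma no_subdivided_K23_around:
  assumes "x \<in> A" "{y3, a, y2, y1} \<subseteq> A" "{w1, w2, w3} \<subseteq> B" "distinct [y3, a, y2, y1]" "distinct [w1, w2, w3]"
    and "F x w1" "F x w2" "F x w3"
    and "E y3 w1" "E y3 w2" "E a w1" "E a w2" "E y2 w1" "E y2 w3" "E y1 w3" "E y1 w2"
  shows False
proof -
  have nE: "\<not> E x w1" "\<not> E x w2" "\<not> E x w3" using assms compl by simp_all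
  then have ne: "x \<noteq> y3" "x \<noteq> a" "x \<noteq> y2" "x \<noteq> y1" using assms by auto
  obtain n1 where n1: "n1 \<in> B" "E x n1" "E y3 n1" using comE_A[of x y3] assms(1,2) ne by auto
  obtain n2 where n2: "n2 \<in> B" "E x n2" "E a n2" using comE_A[of x a] assms(1,2) ne by auto
  obtain n3 where n3: "n3 \<in> B" "E x n3" "E y2 n3" using comE_A[of x y2] assms(1,2) ne by auto
  have AB: "u \<noteq> v" if "u \<in> A" "v \<in> B" for u v using that disjoint by blast
  have "distinct [w1, w2, y3, a, y2, w3, y1]"
    using assms(2-5) AB by auto
  moreover have "{n1, n2, n3} \<inter> {w1, w2, w3} = {}" using n1 n2 n3 nE by auto
  then have "{x, n1, n2, n3} \<inter> {w1, w2, y3, a, y2, w3, y1} = {}"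
    using n1(1) n2(1) n3(1) assms(1-3) ne AB by auto
  ultimately have "tripod_on_subdivided_K23 E"
    by (rule tripod_on_subdivided_K23I)
      (fact n1 n2 n3 assms symE[OF n1(3)] symE[OF n2(3)] symE[OF n3(3)]
        symE[OF assms(9)] symE[OF assms(11)] symE[OF assms(13)] symE[OF assms(15)])+
  then show False using no_subdivided_K23 by simp
qed

text \<open>By minimality, each member \<open>w\<close> of the cover is the only non-neighbour in
  the cover of some vertex \<open>pt w\<close>. There are at least three members, since a common
  neighbour of two of them must miss a third.\<close>

lemma ex_triangle:
  assumes x: "x \<in> A"
  obtains w1 w2 w3 y1 y2 y3 where "triangle x w1 w2 w3 y1 y2 y3"
proof -
  define cover where "cover W \<longleftrightarrow> W \<subseteq> {w \<in> B. F x w} \<and> (\<forall>y\<in>A - {x}. \<exists>w\<in>W. F y w)" for W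
  have "cover {w \<in> B. F x w}"
    unfolding cover_def using comF_A x by blast
  then obtain W where W: "cover W" and least: "\<And>W'. cover W' \<Longrightarrow> card W \<le> card W'"
    using ex_has_least_nat[of cover _ card] by blast
  have W_hit: "\<exists>w\<in>W. F y w" if "y \<in> A" "y \<noteq> x" for y
    using W that unfolding cover_def by simp
  have fin: "finite W" and W_B: "\<And>w. w \<in> W \<Longrightarrow> w \<in> B \<and> F x w"
    using W finite_B finite_subset unfolding cover_def by (auto intro: finite_subset)
  have "\<exists>y. y \<in> A \<and> F y w \<and> (\<forall>w'\<in>W - {w}. E y w')" if w: "w \<in> W" for w
  proof -
    have "\<not> cover (W - {w})"
      using least[of "W - {w}"] card_Diff1_less[OF fin w] by linarith
    then obtain y where "y \<in> A - {x}" "\<forall>w'\<in>W - {w}. \<not> F y w'"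
      using W unfolding cover_def by blast
    then show ?thesis
      using W W_B compl unfolding cover_def by blast
  qed
  then obtain pt where pt: "\<And>w. w \<in> W \<Longrightarrow> pt w \<in> A" "\<And>w. w \<in> W \<Longrightarrow> F (pt w) w"
      "\<And>w w'. w \<in> W \<Longrightarrow> w' \<in> W \<Longrightarrow> w' \<noteq> w \<Longrightarrow> E (pt w) w'"
    by (metis Diff_iff singletonD)
  have nEx: "\<not> E x w" if "w \<in> W" for w using W_B[OF that] compl x by blast
  \<comment> \<open>At \<open>x\<close> itself the cover only has to be nonempty, since
    \<open>x\<close> is adjacent to none of its members; \<open>a'\<close>, being different from
    \<open>x\<close>, ensures this.\<close>
  have hit: "\<exists>w\<in>W. \<not> E a w" if a: "a \<in> A" for a
  proof (cases "a = x")
    case True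
    obtain b where b: "b \<in> B" "F x b" using nbrF_A[OF x] by blast
    then obtain a' where "a' \<in> A" "E a' b" using nbrE_B by blast
    moreover have "a' \<noteq> x" using b compl[OF x b(1)] \<open>E a' b\<close> by metis
    ultimately obtain w where "w \<in> W" using W_hit by metis
    then show ?thesis using nEx True by metis
  next
    case False
    then obtain w where "w \<in> W" "F a w" using W_hit a by metis
    then show ?thesis using W_B[of w] compl[OF a, of w] by metis
  qed
  obtain w1 where w1: "w1 \<in> W" using hit[OF x] by blast
  obtain a where "a \<in> A" "E a w1" using nbrE_B W_B[OF w1] by blast
  then obtain w2 where w2: "w2 \<in> W" "w2 \<noteq> w1" using hit by metis
  obtain a where "a \<in> A" "E a w1" "E a w2"
    using comE_B[of w1 w2] W_B[OF w1] W_B[OF w2(1)] w2(2) by metis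
  then obtain w3 where w3: "w3 \<in> W" "w3 \<noteq> w1" "w3 \<noteq> w2" using hit by metis
  have "triangle x w1 w2 w3 (pt w1) (pt w2) (pt w3)"
    unfolding triangle_def using w1 w2 w3 pt W_B by auto
  then show ?thesis using that by blast
qed

lemma triangle_rotate: "triangle x w1 w2 w3 y1 y2 y3 \<Longrightarrow> triangle x w2 w3 w1 y2 y3 y1"
  unfolding triangle_def by auto

lemma triangle_distinct:
  assumes "triangle x w1 w2 w3 y1 y2 y3" "x \<in> A"
  shows "distinct [w1, w2, w3]" "distinct [x, y1, y2, y3]"
  using assms compl unfolding triangle_def by auto

text \<open>With both sides and relations exchanged, a triangle for \<open>b\<close> contains three
  distinct \<open>E\<close>-neighbours of \<open>b\<close>.\<close>

lemma degree_ge_3: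
  assumes "b \<in> B"
  obtains a where "a \<in> A" "E a b" "a \<noteq> y" "a \<noteq> y'"
proof -
  interpret flip: co_planar_bipartite B A F E
    using co_planar_bipartite.swap_sides[OF swap_relations] .
  obtain w1 w2 w3 y1 y2 y3 where "flip.triangle b w1 w2 w3 y1 y2 y3"
    using flip.ex_triangle[OF assms] .
  then have w: "w1 \<in> A" "w2 \<in> A" "w3 \<in> A" "E b w1" "E b w2" "E b w3" "distinct [w1, w2, w3]"
    using flip.triangle_distinct(1)[OF _ assms] unfolding flip.triangle_def by simp_all
  from w symE[OF w(4)] symE[OF w(5)] symE[OF w(6)] show thesis
    using that[of w1] that[of w2] that[of w3] by auto
qed

text \<open>A second common neighbour would supply the path through \<open>a\<close> in
  \<open>no_subdivided_K23_around\<close>; the other two paths come from the triangle.\<close>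

lemma triangle_common_E:
  assumes t: "triangle x w1 w2 w3 y1 y2 y3" and x: "x \<in> A"
    and a: "a \<in> A" "E a w1" "E a w2"
  shows "a = y3"
proof (rule ccontr)
  assume "a \<noteq> y3"
  moreover have "a \<noteq> y1" "a \<noteq> y2" using t a compl unfolding triangle_def by auto
  ultimately show False
    using no_subdivided_K23_around[of x y3 a y2 y1 w1 w2 w3] t x a triangle_distinct[OF t x]
    unfolding triangle_def by auto
qed

text \<open>Otherwise \<open>x\<close>, \<open>a\<close>, \<open>b\<close> are three common
  \<open>F\<close>-neighbours of \<open>w1\<close> and \<open>w2\<close>. Since \<open>y3\<close> is
  \<open>F\<close>-adjacent to neither, it is the centre of a tripod on this \<open>K23\<close> in
  \<open>F\<close>.\<close>

lemma triangle_common_F: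
  assumes t: "triangle x w1 w2 w3 y1 y2 y3" and x: "x \<in> A"
    and a: "a \<in> A - {x}" "F a w1" "F a w2" and b: "b \<in> A - {x}" "F b w1" "F b w2"
  shows "a = b"
proof (rule ccontr)
  assume ab: "a \<noteq> b"
  have y3: "y3 \<in> A" "E y3 w1" "E y3 w2" "w1 \<in> B" "w2 \<in> B" "F x w1" "F x w2"
    using t unfolding triangle_def by auto
  then have ne: "y3 \<noteq> x" "y3 \<noteq> a" "y3 \<noteq> b" using a b compl by auto
  obtain n1 where n1: "n1 \<in> B" "F y3 n1" "F x n1" using comF_A[of y3 x] y3 x ne by auto
  obtain n2 where n2: "n2 \<in> B" "F y3 n2" "F a n2" using comF_A[of y3 a] y3 a ne by auto
  obtain n3 where n3: "n3 \<in> B" "F y3 n3" "F b n3" using comF_A[of y3 b] y3 b ne by auto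
  have AB: "u \<noteq> v" if "u \<in> A" "v \<in> B" for u v using that disjoint by blast
  have "distinct [w1, w2, x, a, b]"
    using y3 x a b ab AB triangle_distinct[OF t x] by auto
  moreover have "{n1, n2, n3} \<inter> {w1, w2} = {}"
    using n1 n2 n3 y3 compl by auto
  then have "{y3, n1, n2, n3} \<inter> {w1, w2, x, a, b} = {}"
    using n1(1) n2(1) n3(1) y3(1,4,5) x a(1) b(1) ne AB by auto
  ultimately have "tripod_on_K23 F"
    by (rule tripod_on_K23I)
      (fact n1 n2 n3 a b y3 symF[OF n1(3)] symF[OF n2(3)] symF[OF n3(3)]
        symF[OF y3(6)] symF[OF a(2)] symF[OF b(2)])+
  then show False using no_K23 by simp
qed

lemma card_A: "card A = 7"
proof -
  obtain x where x: "x \<in> A" using nonempty by blast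
  obtain w1 w2 w3 y1 y2 y3 where t: "triangle x w1 w2 w3 y1 y2 y3"
    using ex_triangle[OF x] .
  have t': "triangle x w2 w3 w1 y2 y3 y1" "triangle x w3 w1 w2 y3 y1 y2"
    using t triangle_rotate by blast+
  have w: "w1 \<in> B" "w2 \<in> B" "w3 \<in> B" and y: "y1 \<in> A" "y2 \<in> A" "y3 \<in> A"
    and Fx: "F x w1" "F x w2" "F x w3"
    using t unfolding triangle_def by auto
  note cE = triangle_common_E[OF t x] triangle_common_E[OF t'(1) x] triangle_common_E[OF t'(2) x]
  note cF = triangle_common_F[OF t x] triangle_common_F[OF t'(1) x] triangle_common_F[OF t'(2) x]
  obtain z1 where z1: "z1 \<in> A" "E z1 w1" "z1 \<noteq> y2" "z1 \<noteq> y3" using degree_ge_3[OF w(1)] .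
  obtain z2 where z2: "z2 \<in> A" "E z2 w2" "z2 \<noteq> y3" "z2 \<noteq> y1" using degree_ge_3[OF w(2)] .
  obtain z3 where z3: "z3 \<in> A" "E z3 w3" "z3 \<noteq> y1" "z3 \<noteq> y2" using degree_ge_3[OF w(3)] .
  \<comment> \<open>Adjacency of \<open>z1\<close> to \<open>w2\<close> or \<open>w3\<close> would
    make it the corner \<open>y3\<close> or \<open>y2\<close>; likewise for \<open>z2\<close> and
    \<open>z3\<close>.\<close>
  have Fz: "F z1 w2" "F z1 w3" "F z2 w1" "F z2 w3" "F z3 w1" "F z3 w2"
    using compl[OF z1(1)] compl[OF z2(1)] compl[OF z3(1)] cE(1)[OF z1(1)] cE(3)[OF z1(1)]
      cE(1)[OF z2(1)] cE(2)[OF z2(1)] cE(2)[OF z3(1)] cE(3)[OF z3(1)] z1 z2 z3 w by metis+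
  have d: "distinct [x, y1, y2, y3, z1, z2, z3]"
    using triangle_distinct[OF t x] z1 z2 z3 Fz Fx w compl t x unfolding triangle_def by auto
  have "a \<in> {x, y1, y2, y3, z1, z2, z3}" if a: "a \<in> A" for a
  proof (rule ccontr)
    assume "\<not> ?thesis"
    then have ne: "a \<noteq> x" "a \<noteq> y1" "a \<noteq> y2" "a \<noteq> y3" "a \<noteq> z1" "a \<noteq> z2" "a \<noteq> z3" by auto
    \<comment> \<open>Apart from \<open>x\<close>, only \<open>z3\<close>, \<open>z1\<close> and
      \<open>z2\<close> are \<open>F\<close>-adjacent to the respective pairs. So \<open>a\<close>
      is \<open>E\<close>-adjacent to two of the \<open>wi\<close> and must be a corner.\<close>
    have "\<not> (F a w1 \<and> F a w2)" "\<not> (F a w2 \<and> F a w3)" "\<not> (F a w3 \<and> F a w1)"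
      using cF(1)[of a z3] cF(2)[of a z1] cF(3)[of a z2] ne a d Fz z1 z2 z3 by auto
    then show False using cE[of a] ne a w compl by blast
  qed
  then have "A = set [x, y1, y2, y3, z1, z2, z3]"
    using x y z1 z2 z3 by auto
  then show ?thesis using distinct_card[OF d] by simp
qed

lemma card_B: "card B = 7"
  using co_planar_bipartite.card_A[OF swap_sides] .

end

subsection \<open>Square-complementary bipartite graphs\<close>

definition distance_ge_3 :: "'a set \<Rightarrow> ('a \<Rightarrow> 'a \<Rightarrow> bool) \<Rightarrow> 'a \<Rightarrow> 'a \<Rightarrow> bool" where
  "distance_ge_3 V E u v \<longleftrightarrow>
     u \<in> V \<and> v \<in> V \<and> u \<noteq> v \<and> \<not> E u v \<and> \<not> (\<exists>w. E u w \<and> E w v)"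

text \<open>Applied to the isomorphism from the far pairs to the edges: the far graph thus inherits
  the exclusion of tripods from \<open>E\<close>.\<close>

lemma tripod_on_K23_image:
  assumes "tripod_on_K23 E" "inj_on f V" "\<And>u v. E u v \<Longrightarrow> u \<in> V \<and> v \<in> V \<and> E' (f u) (f v)"
  shows "tripod_on_K23 E'"
proof -
  obtain x n1 n2 n3 s t p q r where *: "distinct [s, t, p, q, r]" "{x, n1, n2, n3} \<inter> {s, t, p, q, r} = {}"
     "E x n1" "E x n2" "E x n3" "E n1 p" "E n2 q" "E n3 r"
     "E s p" "E p t" "E s q" "E q t" "E s r" "E r t"
    using assms(1) unfolding tripod_on_K23_def by (elim exE conjE)
  have V: "{x, n1, n2, n3} \<subseteq> V" "set [s, t, p, q, r] \<subseteq> V"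
    using * assms(3) by auto
  have "distinct (map f [s, t, p, q, r])"
    unfolding distinct_map using *(1) inj_on_subset[OF assms(2) V(2)] by (rule conjI)
  moreover have "f ` {x, n1, n2, n3} \<inter> f ` set [s, t, p, q, r] = {}"
    using inj_on_image_Int[OF assms(2) V] *(2) by simp
  ultimately have "distinct [f s, f t, f p, f q, f r]"
      "{f x, f n1, f n2, f n3} \<inter> {f s, f t, f p, f q, f r} = {}"
    by simp_all
  then show ?thesis
    by (rule tripod_on_K23I) (use *(3-) assms(3) in blast)+
qed

lemma tripod_on_subdivided_K23_image:
  assumes "tripod_on_subdivided_K23 E" "inj_on f V" "\<And>u v. E u v \<Longrightarrow> u \<in> V \<and> v \<in> V \<and> E' (f u) (f v)"
  shows "tripod_on_subdivided_K23 E'"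
proof -
  obtain x n1 n2 n3 s t p q r w r' where *: "distinct [s, t, p, q, r, w, r']"
     "{x, n1, n2, n3} \<inter> {s, t, p, q, r, w, r'} = {}"
     "E x n1" "E x n2" "E x n3" "E n1 p" "E n2 q" "E n3 r"
     "E s p" "E p t" "E s q" "E q t" "E s r" "E r w" "E w r'" "E r' t"
    using assms(1) unfolding tripod_on_subdivided_K23_def by (elim exE conjE)
  have V: "{x, n1, n2, n3} \<subseteq> V" "set [s, t, p, q, r, w, r'] \<subseteq> V"
    using * assms(3) by auto
  have "distinct (map f [s, t, p, q, r, w, r'])"
    unfolding distinct_map using *(1) inj_on_subset[OF assms(2) V(2)] by (rule conjI)
  moreover have "f ` {x, n1, n2, n3} \<inter> f ` set [s, t, p, q, r, w, r'] = {}"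
    using inj_on_image_Int[OF assms(2) V] *(2) by simp
  ultimately have "distinct [f s, f t, f p, f q, f r, f w, f r']"
      "{f x, f n1, f n2, f n3} \<inter> {f s, f t, f p, f q, f r, f w, f r'} = {}"
    by simp_all
  then show ?thesis
    by (rule tripod_on_subdivided_K23I) (use *(3-) assms(3) in blast)+
qed

text \<open>Complementing both sides of the squco condition turns its isomorphism into one from the
  pairs at distance at least three to the edges.\<close>

locale bipartite_squco =
  fixes A B :: "'a set" and E :: "'a \<Rightarrow> 'a \<Rightarrow> bool" and f :: "'a \<Rightarrow> 'a"
  assumes finite_A: "finite A" and finite_B: "finite B" and disjoint: "A \<inter> B = {}"
    and symE: "E u v \<Longrightarrow> E v u"
    and cross: "E u v \<Longrightarrow> u \<in> A \<and> v \<in> B \<or> u \<in> B \<and> v \<in> A"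
    and bij: "bij_betw f (A \<union> B) (A \<union> B)"
    and far_iff: "u \<in> A \<union> B \<Longrightarrow> v \<in> A \<union> B \<Longrightarrow> distance_ge_3 (A \<union> B) E u v \<longleftrightarrow> E (f u) (f v)"
    and nontrivial: "\<exists>u\<in>A \<union> B. \<exists>v\<in>A \<union> B. u \<noteq> v"
begin

abbreviation "far \<equiv> distance_ge_3 (A \<union> B) E"

lemma swap_sides: "bipartite_squco B A E f"
proof
  show "B \<inter> A = {}" using disjoint by blast
  show "u \<in> B \<and> v \<in> A \<or> u \<in> A \<and> v \<in> B" if "E u v" for u v using cross[OF that] by blast
  show "bij_betw f (B \<union> A) (B \<union> A)" using bij by (simp only: Un_commute)
  show "distance_ge_3 (B \<union> A) E u v \<longleftrightarrow> E (f u) (f v)" if "u \<in> B \<union> A" "v \<in> B \<union> A" for u v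
    using far_iff[of u v] that by (simp only: Un_commute[of B A])
  show "\<exists>u\<in>B \<union> A. \<exists>v\<in>B \<union> A. u \<noteq> v" using nontrivial by (simp only: Un_commute[of B A])
qed (fact finite_A finite_B symE)+

lemma far_sym: "far u v \<Longrightarrow> far v u"
  unfolding distance_ge_3_def using symE by blast

lemma f_in: "u \<in> A \<union> B \<Longrightarrow> f u \<in> A \<union> B"
  using bij by (auto simp: bij_betw_def)

lemma f_preimage:
  assumes "v \<in> A \<union> B"
  obtains u where "u \<in> A \<union> B" "f u = v"
  using assms bij by (metis bij_betw_def imageE)

lemma f_inj: "u \<in> A \<union> B \<Longrightarrow> v \<in> A \<union> B \<Longrightarrow> f u = f v \<Longrightarrow> u = v"
  using bij by (auto simp: bij_betw_def dest: inj_onD)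

lemma far_image: "far u v \<Longrightarrow> E (f u) (f v)"
  using far_iff unfolding distance_ge_3_def by blast

lemma far_across: "a \<in> A \<Longrightarrow> b \<in> B \<Longrightarrow> far a b \<longleftrightarrow> \<not> E a b"
  unfolding distance_ge_3_def using cross disjoint by blast

lemma far_same_side: "u \<in> A \<Longrightarrow> v \<in> A \<Longrightarrow> far u v \<longleftrightarrow> u \<noteq> v \<and> \<not> (\<exists>w\<in>B. E u w \<and> E v w)"
  unfolding distance_ge_3_def using cross disjoint symE by blast

text \<open>An isolated \<open>v\<close> is far from every other vertex \<open>z\<close>, so
  \<open>f v\<close> is adjacent to \<open>f z\<close>. If \<open>f v = v\<close>, this is an edge
  at \<open>v\<close>; otherwise take the \<open>z\<close> with \<open>f z = v\<close>.\<close>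

lemma no_isolated:
  assumes v: "v \<in> A \<union> B"
  shows "\<exists>u. E v u"
proof (rule ccontr)
  assume iso: "\<not> ?thesis"
  have far: "far v u" if "u \<in> A \<union> B" "u \<noteq> v" for u
    using iso v that unfolding distance_ge_3_def by blast
  obtain u where u: "u \<in> A \<union> B" "f u = v" using f_preimage[OF v] .
  obtain z where z: "z \<in> A \<union> B" "z \<noteq> v" using nontrivial by blast
  show False
  proof (cases "u = v")
    case True
    then show False using far_image[OF far[OF z]] u iso by simp
  next
    case False
    then show False using far_image[OF far[OF u(1)]] u iso symE by metis
  qed
qed

lemma no_far_isolated:
  assumes v: "v \<in> A \<union> B"
  shows "\<exists>u. far v u"
proof -
  obtain w where w: "E (f v) w" using no_isolated f_in[OF v] by blast
  then obtain u where "u \<in> A \<union> B" "f u = w" using f_preimage cross by (metis UnI1 UnI2)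
  then show ?thesis using far_iff[OF v] w by blast
qed

lemma nbr:
  assumes "a \<in> A"
  shows "\<exists>b\<in>B. E a b"
  using no_isolated[of a] assms cross disjoint by blast

text \<open>If the vertex \<open>u\<close> far from \<open>a\<close> lies on the same side, then any
  neighbour of \<open>u\<close> is a non-neighbour of \<open>a\<close>.\<close>

lemma non_nbr:
  assumes "a \<in> A"
  shows "\<exists>b\<in>B. far a b"
proof -
  obtain u where u: "far a u" using no_far_isolated assms by blast
  show ?thesis
  proof (cases "u \<in> A")
    case True
    then obtain b where "b \<in> B" "E u b" using nbr by blast
    then show ?thesis
      using u assms True far_same_side far_across by blast
  next
    case False
    then show ?thesis using u unfolding distance_ge_3_def by blast
  qed
qed

text \<open>The bipartition of \<open>E\<close> pulled back along \<open>f\<close>: a proper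
  2-colouring of the far graph, with no evident relation to the sides \<open>A\<close> and
  \<open>B\<close>.\<close>

definition colour :: "'a \<Rightarrow> bool" where "colour z \<longleftrightarrow> f z \<in> A"

lemma far_colour: "far u v \<Longrightarrow> colour u \<noteq> colour v"
  using far_image[of u v] cross disjoint unfolding colour_def by blast

lemma far_no_triangle: "far u v \<Longrightarrow> far u w \<Longrightarrow> far v w \<Longrightarrow> False"
  using far_colour by blast

text \<open>A vertex \<open>w\<close> adjacent to both would contradict \<open>far u v\<close>; one
  adjacent to neither would complete a triangle of far pairs.\<close>

lemma far_imp_complementary:
  assumes "u \<in> A" "v \<in> A" "far u v" "w \<in> B"
  shows "E u w \<longleftrightarrow> \<not> E v w"
  using far_no_triangle[OF assms(3), of w] far_same_side assms far_across by blast

lemma complementary: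
  assumes "far u v" "u \<in> A \<and> v \<in> A \<and> w \<in> B \<or> u \<in> B \<and> v \<in> B \<and> w \<in> A"
  shows "E u w \<or> E v w"
  using far_imp_complementary[of u v w] bipartite_squco.far_imp_complementary[OF swap_sides, of u v w]
    assms by (auto simp: Un_commute)

text \<open>This is \<open>complementary\<close> for \<open>f y\<close> and \<open>f y'\<close>,
  pulled back along \<open>f\<close>: these lie on one side and have no common neighbour.\<close>

lemma far_complementary:
  assumes y: "y \<in> A \<union> B" "y' \<in> A \<union> B" "y \<noteq> y'" "colour y = colour y'"
    and none: "\<And>t. \<not> (far y t \<and> far y' t)"
    and t: "t \<in> A \<union> B" "colour t \<noteq> colour y"
  shows "far y t \<or> far y' t"
proof -
  have "f y \<noteq> f y'" using f_inj y by blast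
  moreover have same: "f y \<in> A \<and> f y' \<in> A \<or> f y \<in> B \<and> f y' \<in> B"
    using y f_in[of y] f_in[of y'] unfolding colour_def by blast
  moreover have "\<not> (E (f y) w \<and> E w (f y'))" for w
  proof
    assume w: "E (f y) w \<and> E w (f y')"
    then obtain z where "z \<in> A \<union> B" "f z = w" using f_preimage cross by (metis UnI1 UnI2)
    then show False using none[of z] far_iff y w symE by blast
  qed
  moreover have "\<not> E (f y) (f y')" using same cross disjoint by blast
  ultimately have far: "far (f y) (f y')"
    unfolding distance_ge_3_def using f_in y by blast
  have "f y \<in> A \<and> f y' \<in> A \<and> f t \<in> B \<or> f y \<in> B \<and> f y' \<in> B \<and> f t \<in> A"
    using same t f_in[of t] y disjoint unfolding colour_def by blast
  then have "E (f y) (f t) \<or> E (f y') (f t)" by (rule complementary[OF far])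
  then show ?thesis using far_iff t(1) y by blast
qed

text \<open>The far pair determines the colours in \<open>B\<close>: neighbours of \<open>u\<close>
  share its colour, neighbours of \<open>v\<close> have the other. The cases are the sides of
  \<open>y\<close> and \<open>y'\<close>.\<close>

lemma common_far_of_far_pair:
  assumes uv: "u \<in> A" "v \<in> A" "far u v"
    and y: "y \<in> A \<union> B" "y' \<in> A \<union> B" "y \<noteq> y'" "colour y = colour u" "colour y' = colour u"
  shows "\<exists>t. far y t \<and> far y' t"
proof (rule ccontr)
  assume "\<not> ?thesis"
  then have none: "\<And>t. \<not> (far y t \<and> far y' t)" by blast
  note cover = far_complementary[OF y(1-3) _ none]
  have v: "colour v \<noteq> colour u" using far_colour uv by blast
  have u_or_v: "E u b \<longleftrightarrow> \<not> E v b" if "b \<in> B" for b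
    using far_imp_complementary[OF uv that] .
  have colour_B: "colour b = colour u \<longleftrightarrow> E u b" if "b \<in> B" for b
    using u_or_v[OF that] far_across[OF uv(1) that] far_across[OF uv(2) that] far_colour v by blast
  \<comment> \<open>\<open>b\<close> has the colour of \<open>x\<close>, so the two are not far
    apart.\<close>
  have A_complete: "E x b" if "x \<in> A" "colour x = colour u" "b \<in> B" "E u b" for x b
    using far_across[OF that(1,3)] far_colour[of x b] colour_B[OF that(3)] that by blast
  have A_misses: "\<exists>b\<in>B. E v b \<and> far x b" if "x \<in> A" "colour x = colour u" for x
    using non_nbr[OF that(1)] A_complete[OF that] u_or_v far_across[OF that(1)] by blast
  have A_far_v: "far x b" if "x \<in> A" "b \<in> B" "E v b" "far x v" for x b
    using far_same_side[OF that(1) uv(2)] far_across[OF that(1,2)] that by blast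
  \<comment> \<open>Some neighbour of \<open>v\<close> is far from \<open>z'\<close> by
    \<open>A_misses\<close>, and also from \<open>z\<close>, which shares no neighbour with
    \<open>v\<close>.\<close>
  have AA: False if "z \<in> A" "z' \<in> A" "{z, z'} = {y, y'}" "far z v" for z z'
    using A_misses[of z'] A_far_v[of z] that none y by (auto simp: doubleton_eq_iff)
  have AB: False if z: "z \<in> A" "z' \<in> B" "{z, z'} = {y, y'}" for z z'
  proof -
    have z': "E u z'" and colour_z: "colour z = colour u" using colour_B z y by (auto simp: doubleton_eq_iff)
    have far_z'v: "far z' v" using far_across[OF uv(2) z(2)] u_or_v[OF z(2)] z' far_sym by blast
    show False
    proof (cases "far z v")
      case True
      then show False using far_z'v none z by (auto simp: doubleton_eq_iff)
    next
      case False
      moreover have "z \<noteq> v" using colour_z v by blast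
      ultimately obtain q where q: "q \<in> B" "E z q" "E v q"
        using far_same_side[OF z(1) uv(2)] by blast
      have "colour q \<noteq> colour u" using colour_B[OF q(1)] u_or_v[OF q(1)] q by blast
      then have "far z q \<or> far z' q" using cover[of q] q z y by (auto simp: doubleton_eq_iff)
      moreover have "\<not> far z q" using far_across[OF z(1) q(1)] q by blast
      \<comment> \<open>\<open>z\<close> is a common neighbour of \<open>z'\<close> and
        \<open>q\<close>.\<close>
      moreover have "\<not> far z' q"
        using A_complete[OF z(1) colour_z z(2) z'] q symE unfolding distance_ge_3_def by blast
      ultimately show False by blast
    qed
  qed
  \<comment> \<open>Both are neighbours of \<open>u\<close>, hence not of \<open>v\<close>, so
    \<open>v\<close> is far from both.\<close>
  have BB: False if "y \<in> B" "y' \<in> B"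
  proof -
    have "E u y" "E u y'" using colour_B that y by blast+
    then show False
      using u_or_v[OF that(1)] u_or_v[OF that(2)] far_across[OF uv(2) that(1)]
        far_across[OF uv(2) that(2)] none[of v] far_sym by blast
  qed
  have "far y v \<or> far y' v" if "y \<in> A" "y' \<in> A"
    using cover[of v] v uv y by auto
  then show False
    using AA[of y y'] AA[of y' y] AB[of y y'] AB[of y' y] BB y(1,2) by blast
qed

text \<open>The preimages of \<open>u\<close> and \<open>v\<close> have equal colours. As
  \<open>u\<close> and \<open>v\<close> are coloured differently, one of them has that colour, and
  \<open>common_far_of_far_pair\<close> applies to it; the image of the common far vertex is a
  common neighbour of \<open>u\<close> and \<open>v\<close>.\<close>

lemma not_far_same_side:
  assumes uv: "u \<in> A" "v \<in> A"
  shows "\<not> far u v"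
proof
  assume far: "far u v"
  obtain y where y: "y \<in> A \<union> B" "f y = u" using f_preimage uv by (metis UnI1)
  obtain y' where y': "y' \<in> A \<union> B" "f y' = v" using f_preimage uv by (metis UnI1)
  have "y \<noteq> y'" using y y' far unfolding distance_ge_3_def by blast
  moreover have "colour y = colour y'" using y y' uv unfolding colour_def by simp
  moreover have "colour v \<noteq> colour u" using far_colour far by blast
  ultimately obtain t where "far y t" "far y' t"
    using common_far_of_far_pair[OF uv far y(1) y'(1)]
      common_far_of_far_pair[OF uv(2,1) far_sym[OF far] y(1) y'(1)] by metis
  then have "E u (f t)" "E v (f t)" using far_image y y' by metis+
  then show False using far symE unfolding distance_ge_3_def by blast
qed

lemma common_nbr: "u \<in> A \<Longrightarrow> v \<in> A \<Longrightarrow> u \<noteq> v \<Longrightarrow> \<exists>w\<in>B. E u w \<and> E v w"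
  using not_far_same_side far_same_side by blast

lemma far_cross: "far u v \<Longrightarrow> u \<in> A \<and> v \<in> B \<or> u \<in> B \<and> v \<in> A"
  using not_far_same_side[of u v] bipartite_squco.not_far_same_side[OF swap_sides, of u v]
  unfolding distance_ge_3_def by (auto simp: Un_commute)

lemma common_far_of_colour:
  assumes y: "y \<in> A \<union> B" "y' \<in> A \<union> B" "y \<noteq> y'" "colour y = colour y'"
  shows "\<exists>t. far y t \<and> far y' t"
proof -
  have "f y \<noteq> f y'" using f_inj y by blast
  moreover have "f y \<in> A \<and> f y' \<in> A \<or> f y \<in> B \<and> f y' \<in> B"
    using y f_in[of y] f_in[of y'] unfolding colour_def by blast
  ultimately obtain w where w: "E (f y) w" "E (f y') w"
    using common_nbr[of "f y" "f y'"] bipartite_squco.common_nbr[OF swap_sides, of "f y" "f y'"]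
    symE by metis
  then obtain z where "z \<in> A \<union> B" "f z = w" using f_preimage cross by (metis UnI1 UnI2)
  then show ?thesis using far_iff y w by blast
qed

text \<open>Colours now follow the sides: a common far vertex of some \<open>x\<close> in
  \<open>A\<close> and \<open>b\<close> in \<open>B\<close> would lie on both sides. Hence
  \<open>u\<close> and \<open>v\<close> have the same colour.\<close>

lemma common_far:
  assumes u: "u \<in> A" "v \<in> A" "u \<noteq> v"
  shows "\<exists>w\<in>B. far u w \<and> far v w"
proof -
  have same: False if "x \<in> A" "b \<in> B" "colour x = colour b" for x b
    using common_far_of_colour[of x b] that disjoint far_cross by blast
  obtain b where "b \<in> B" using nbr u by blast
  then have "colour u = colour v" using same u by blast
  then obtain t where "far u t" "far v t" using common_far_of_colour[of u v] u by blast
  then show ?thesis using far_cross u disjoint by blast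
qed

text \<open>Planarity enters only as the absence of both configurations. It forces 49 pairs across
  the sides, which cannot split evenly between edges and far pairs.\<close>

lemma has_tripod: "tripod_on_K23 E \<or> tripod_on_subdivided_K23 E"
proof (rule ccontr)
  assume no: "\<not> ?thesis"
  interpret sw: bipartite_squco B A E f by (rule swap_sides)
  have sw_far: "distance_ge_3 (B \<union> A) E = far" by (simp add: Un_commute)
  have inj: "inj_on f (A \<union> B)" using bij by (simp add: bij_betw_def)
  have far_V: "u \<in> A \<union> B \<and> v \<in> A \<union> B \<and> E (f u) (f v)" if "far u v" for u v
    using that far_image unfolding distance_ge_3_def by blast
  have no_far: "\<not> tripod_on_K23 far" "\<not> tripod_on_subdivided_K23 far"
    using no tripod_on_K23_image[OF _ inj far_V] tripod_on_subdivided_K23_image[OF _ inj far_V] by blast+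
  have "A \<noteq> {}" using nontrivial sw.nbr by blast
  interpret co_planar_bipartite A B E far
  proof
    show "\<exists>a\<in>A. E a x \<and> E a y" if "x \<in> B" "y \<in> B" "x \<noteq> y" for x y
      using sw.common_nbr[OF that] symE by blast
    show "\<exists>a\<in>A. far a x \<and> far a y" if "x \<in> B" "y \<in> B" "x \<noteq> y" for x y
      using sw.common_far[OF that] far_sym unfolding sw_far by blast
    show "\<exists>a\<in>A. far a b" if "b \<in> B" for b
      using sw.non_nbr[OF that] far_sym unfolding sw_far by blast
    show "\<exists>a\<in>A. E a b" if "b \<in> B" for b
      using sw.nbr[OF that] symE by blast
  qed (use finite_A finite_B disjoint symE far_sym far_across nbr non_nbr common_nbr common_far no no_far
      \<open>A \<noteq> {}\<close> in \<open>simp_all\<close>)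
  \<comment> \<open>\<open>P\<close> counts each pair once, from \<open>A\<close> to
    \<open>B\<close>. The map \<open>f\<close> may exchange sides, so the bijection is set up on
    \<open>Q\<close>, which contains both orientations.\<close>
  define P where "P R = {(u, v). R u v \<and> u \<in> A \<and> v \<in> B}" for R
  define Q where "Q R = {(u, v). R u v}" for R :: "'a \<Rightarrow> 'a \<Rightarrow> bool"
  have fin: "finite (P R)" for R
    unfolding P_def by (rule finite_subset[of _ "A \<times> B"]) (use finite_A finite_B in auto)
  have card_Q: "card (Q R) = 2 * card (P R)"
    if R: "\<And>u v. R u v \<Longrightarrow> R v u" "\<And>u v. R u v \<Longrightarrow> u \<in> A \<and> v \<in> B \<or> u \<in> B \<and> v \<in> A" for R
  proof -
    have "Q R = P R \<union> (P R)\<inverse>" using R unfolding P_def Q_def by blast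
    moreover have "P R \<inter> (P R)\<inverse> = {}" using disjoint unfolding P_def by blast
    ultimately show ?thesis using fin[of R] by (simp add: card_Un_disjoint)
  qed
  have "P E \<union> P far = A \<times> B" "P E \<inter> P far = {}"
    unfolding P_def using far_across by blast+
  then have "card (P E) + card (P far) = 49"
    using card_Un_disjoint[OF fin[of E] fin[of far]] card_A card_B by (simp add: card_cartesian_product)
  moreover have "bij_betw (map_prod f f) (Q far) (Q E)"
  proof (rule bij_betw_imageI)
    show "inj_on (map_prod f f) (Q far)"
      using f_inj far_V unfolding Q_def inj_on_def by (auto simp: map_prod_def)
    show "map_prod f f ` Q far = Q E"
    proof (intro equalityI subsetI)
      fix z assume "z \<in> map_prod f f ` Q far"
      then show "z \<in> Q E" using far_image unfolding Q_def by auto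
    next
      fix z assume "z \<in> Q E"
      then obtain a b where z: "z = (a, b)" "E a b" unfolding Q_def by blast
      then have "a \<in> A \<union> B" "b \<in> A \<union> B" using cross[OF z(2)] by blast+
      then obtain u v where u: "u \<in> A \<union> B" "f u = a" and v: "v \<in> A \<union> B" "f v = b"
        using f_preimage by metis
      then have "far u v" using far_iff z by blast
      then show "z \<in> map_prod f f ` Q far" using u v z unfolding Q_def by force
    qed
  qed
  then have "card (P E) = card (P far)"
    using bij_betw_same_card card_Q[of E] card_Q[of far] symE cross far_sym far_cross by fastforce
  ultimately have "2 * card (P E) = 49" by simp
  then have "even (49 :: nat)" by (metis dvd_triv_left)
  then show False by simp
qed

end

section \<open>From distances and digraph isomorphisms to adjacency\<close>

lemma (in pair_graph) graph_dist_le_2_iff: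
  assumes "u \<in> pverts G" "v \<in> pverts G"
  shows "graph_dist G u v \<le> 2 \<longleftrightarrow>
    u = v \<or> (u, v) \<in> parcs G \<or> (\<exists>w. (u, w) \<in> parcs G \<and> (w, v) \<in> parcs G)"
proof -
  define c :: "'a \<times> 'a \<Rightarrow> real" where "c = (\<lambda>_. 1)"
  have cost: "awalk_cost c p = length p" for p
    by (induction p) (simp_all add: c_def)
  have dist: "graph_dist G u v = \<mu> c u v"
    by (simp add: graph_dist_def c_def)
  have short: "graph_dist G u v \<le> 2" if "awalk u p v" "length p \<le> 2" for p
    using min_cost_le_walk_cost[OF that(1), of c] that(2) unfolding dist cost
    by (auto intro: order_trans)
  have "graph_dist G u v \<le> 2" if "u = v"
    using short[of "[]"] that assms by (simp add: awalk_Nil_iff)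
  moreover have "graph_dist G u v \<le> 2" if "(u, v) \<in> parcs G"
    using short[of "[(u, v)]"] that assms by (simp add: awalk_Cons_iff awalk_Nil_iff)
  moreover have "graph_dist G u v \<le> 2" if "(u, w) \<in> parcs G" "(w, v) \<in> parcs G" for w
    using short[of "[(u, w), (w, v)]"] that assms by (simp add: awalk_Cons_iff awalk_Nil_iff)
  moreover have "3 \<le> graph_dist G u v"
    if far: "u \<noteq> v" "(u, v) \<notin> parcs G" "\<not> (\<exists>w. (u, w) \<in> parcs G \<and> (w, v) \<in> parcs G)"
    unfolding dist \<mu>_def
  \<comment> \<open>It suffices to bound each walk; without any walk the infimum is
    infinite.\<close>
  proof (rule INF_greatest)
    fix p assume "p \<in> {p. awalk u p v}"
    then have p: "awalk u p v" by simp
    have "\<not> length p \<le> 2"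
    proof
      assume "length p \<le> 2"
      then consider "p = []" | e where "p = [e]" | e e' where "p = [e, e']"
        \<comment> \<open>This rule splits lists into those of length zero, one, and at least
          two.\<close>
        by (cases p rule: remdups_adj.cases) auto
      then show False
        using p far by cases (auto simp: awalk_Cons_iff awalk_Nil_iff)
    qed
    then show "3 \<le> ereal (awalk_cost c p)" unfolding cost by simp
  qed
  moreover have "\<not> 3 \<le> (2 :: ereal)" by simp
  ultimately show ?thesis by (metis order_trans)
qed

lemma (in pair_graph) squco_isomorphism:
  assumes "squco G"
  obtains f where "bij_betw f (pverts G) (pverts G)"
    and "\<And>u v. u \<in> pverts G \<Longrightarrow> v \<in> pverts G \<Longrightarrow>
      distance_ge_3 (pverts G) (\<lambda>u v. (u, v) \<in> parcs G) u v \<longleftrightarrow> (f u, f v) \<in> parcs G"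
proof -
  let ?S = "graph_square G" and ?C = "graph_complement G"
  obtain h where h: "pre_digraph.digraph_isomorphism (with_proj ?S) h"
    and C: "with_proj ?C = app_iso h (with_proj ?S)"
    using assms unfolding squco_def digraph_iso_def by blast
  define f where "f = iso_verts h"
  have "pverts ?S = pverts G" "pverts ?C = pverts G"
    by (simp_all add: graph_square_def graph_complement_def)
  then have inj: "inj_on f (pverts G)" and onto: "f ` pverts G = pverts G"
    using h arg_cong[OF C, of verts] by (simp_all add: pre_digraph.digraph_isomorphism_def f_def)
  \<comment> \<open>The target is again a \<open>with_proj\<close> graph, so tails and heads are
    projections and the arc map is determined by the vertex map.\<close>
  have "iso_tail h = fst" "iso_head h = snd" and arcs: "parcs ?C = iso_arcs h ` parcs ?S"
    using arg_cong[OF C, of tail] arg_cong[OF C, of head] arg_cong[OF C, of arcs] by simp_all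
  then have "iso_arcs h (u, v) = (f u, f v)" if "(u, v) \<in> parcs ?S" for u v
    using h that by (auto simp: pre_digraph.digraph_isomorphism_def f_def prod_eq_iff)
  then have "parcs ?C = map_prod f f ` parcs ?S"
    unfolding arcs by (intro image_cong) auto
  moreover have "parcs ?S \<subseteq> pverts G \<times> pverts G" by (auto simp: graph_square_def)
  ultimately have sq_iff: "(u, v) \<in> parcs ?S \<longleftrightarrow> (f u, f v) \<in> parcs ?C"
    if "u \<in> pverts G" "v \<in> pverts G" for u v
  proof -
    have "u = x \<and> v = y" if "f u = f x" "f v = f y" "x \<in> pverts G" "y \<in> pverts G" for x y
      using inj_onD[OF inj] that \<open>u \<in> pverts G\<close> \<open>v \<in> pverts G\<close> by blast
    then show ?thesis
      using \<open>parcs ?C = map_prod f f ` parcs ?S\<close> \<open>parcs ?S \<subseteq> pverts G \<times> pverts G\<close> by auto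
  qed
  have loop: "(u, u) \<notin> parcs G" for u using pair_no_loops by fastforce
  show thesis
  proof
    show "bij_betw f (pverts G) (pverts G)" using inj onto by (simp add: bij_betw_def)
    fix u v assume uv: "u \<in> pverts G" "v \<in> pverts G"
    have f: "f u \<in> pverts G" "f v \<in> pverts G" using onto uv by blast+
    show "distance_ge_3 (pverts G) (\<lambda>u v. (u, v) \<in> parcs G) u v \<longleftrightarrow> (f u, f v) \<in> parcs G"
    proof (cases "u = v")
      case True
      then show ?thesis using loop by (simp add: distance_ge_3_def)
    next
      case False
      then have "f u \<noteq> f v" using inj uv by (auto dest: inj_onD)
      then show ?thesis
        using sq_iff[OF uv] False uv f graph_dist_le_2_iff[OF uv]
        by (auto simp: distance_ge_3_def graph_square_def graph_complement_def)
    qed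
  qed
qed

theorem theorem5p1:
  fixes G :: "'a pair_pre_digraph"
  assumes "pair_graph G"
    and "pverts G \<noteq> {}"
    and "bipartite G"
    and "planar G"
    and "squco G"
  shows "card (pverts G) = 1"
proof (rule ccontr)
  assume card: "card (pverts G) \<noteq> 1"
  interpret pair_graph G by fact
  let ?E = "\<lambda>u v. (u, v) \<in> parcs G"
  obtain A B where AB: "A \<union> B = pverts G" "A \<inter> B = {}" "parcs G \<subseteq> A \<times> B \<union> B \<times> A"
    using \<open>bipartite G\<close> unfolding bipartite_def by blast
  obtain p \<gamma> where "plane_drawing G p \<gamma>"
    using \<open>planar G\<close> unfolding planar_def by blast
  then interpret plane_graph G p \<gamma>
    using \<open>pair_graph G\<close> by unfold_locales
  obtain f where f: "bij_betw f (pverts G) (pverts G)"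
    and far: "\<And>u v. u \<in> pverts G \<Longrightarrow> v \<in> pverts G \<Longrightarrow>
      distance_ge_3 (pverts G) ?E u v \<longleftrightarrow> ?E (f u) (f v)"
    using squco_isomorphism[OF \<open>squco G\<close>] by blast
  have "bipartite_squco A B ?E f"
  proof
    show "finite A" "finite B"
      using AB(1) pair_finite_verts by (auto intro: finite_subset)
    show "\<exists>u\<in>A \<union> B. \<exists>v\<in>A \<union> B. u \<noteq> v"
      using card \<open>pverts G \<noteq> {}\<close> unfolding AB(1) by (metis is_singletonI' is_singleton_altdef)
    show "A \<inter> B = {}" by (rule AB(2))
    show "?E v u" if "?E u v" for u v using that by (rule parcs_sym)
    show "u \<in> A \<and> v \<in> B \<or> u \<in> B \<and> v \<in> A" if "?E u v" for u v using that AB(3) by blast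
    show "bij_betw f (A \<union> B) (A \<union> B)" unfolding AB(1) by (rule f)
    show "distance_ge_3 (A \<union> B) ?E u v \<longleftrightarrow> ?E (f u) (f v)" if "u \<in> A \<union> B" "v \<in> A \<union> B" for u v
      using that unfolding AB(1) by (rule far)
  qed
  then show False
    using bipartite_squco.has_tripod no_tripod_on_K23 no_tripod_on_subdivided_K23 by blast
qed

end
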